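(* The variety of $2$-dimensional transposed Leibniz--Poisson algebras over $\mathbb C$ has exactly three irreducible components: the closures $\overline{O(T_3)}$, $\overline{O(T_4)}$ and $\overline{\bigcup_{\alpha\in\mathbb C}O(T_5^{\alpha})}$.
   Context: A transposed Leibniz--Poisson algebra is a complex vector space with a commutative associative product $\cdot$ and a bilinear bracket $[-,-]$ satisfying $[[x,y],z]=[[x,z],y]+[x,[y,z]]$ and $[x,[y,z]]=[[x,y],z]+[y,[x,z]]$ (symmetric Leibniz), such that $2[x,y]\cdot z=[x\cdot z,y]+[x,y\cdot z]$. Fix a $2$-dimensional complex vector space $V$ with basis $e_1,e_2$. The variety of $2$-dimensional transposed Leibniz--Poisson algebras is the Zariski closed set of pairs $(\mu,\mu')\in \mathrm{Bil}(V\times V,V)^2\cong\mathbb C^{16}$ such that $\mu$ (as $\cdot$) and $\mu'$ (as $[-,-]$) define such an algebra. $\mathrm{GL}(V)$ acts on it by $(g*(\mu,\mu'))(x,y)=(g\mu(g^{-1}x,g^{-1}y),\,g\mu'(g^{-1}x,g^{-1}y))$; $O(T)$ denotes the orbit of (a structure representing) the algebra $T$, and closures are Zariski closures. The algebras are (unlisted products are zero, $\cdot$ is commutative): $T_3: e_1\cdot e_1=e_1,\ e_2\cdot e_2=e_2$; $T_4: e_1\cdot e_1=e_1,\ e_1\cdot e_2=e_2,\ [e_1,e_1]=e_2$; $T_5^{\alpha}: e_1\cdot e_1=e_1,\ e_1\cdot e_2=e_2,\ [e_1,e_2]=\alpha e_2,\ [e_2,e_1]=-\alpha e_2$. *)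

theory Defs
  imports "HOL-Analysis.Analysis"
begin

inductive_set polynomial_functions :: "('a \<Rightarrow> complex) set \<Rightarrow> ('a \<Rightarrow> complex) set"
  for C :: "('a \<Rightarrow> complex) set" where
  const: "(\<lambda>_. c) \<in> polynomial_functions C"
| coord: "f \<in> C \<Longrightarrow> f \<in> polynomial_functions C"
| add: "f \<in> polynomial_functions C \<Longrightarrow> g \<in> polynomial_functions C \<Longrightarrow>
    (\<lambda>x. f x + g x) \<in> polynomial_functions C"
| mult: "f \<in> polynomial_functions C \<Longrightarrow> g \<in> polynomial_functions C \<Longrightarrow>
    (\<lambda>x. f x * g x) \<in> polynomial_functions C"

text \<open>The Zariski topology on a space \<open>S\<close> with coordinate functions \<open>C\<close>: the closed sets are the
  common zero sets in \<open>S\<close> of families of polynomials in the coordinates.\<close>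

definition zariski :: "('a \<Rightarrow> complex) set \<Rightarrow> 'a set \<Rightarrow> 'a topology" where
  "zariski C S = topology (\<lambda>U. \<exists>F \<subseteq> polynomial_functions C. U = S - {x \<in> S. \<forall>f\<in>F. f x = 0})"

lemma istopology_zariski:
  "istopology (\<lambda>U. \<exists>F \<subseteq> polynomial_functions C. U = S - {x \<in> S. \<forall>f\<in>F. f x = 0})"
  (is "istopology ?P")
proof -
  have "?P (U \<inter> V)" if U: "?P U" and V: "?P V" for U V
  proof -
    obtain F G where F: "F \<subseteq> polynomial_functions C" "U = S - {x \<in> S. \<forall>f\<in>F. f x = 0}"
      and G: "G \<subseteq> polynomial_functions C" "V = S - {x \<in> S. \<forall>f\<in>G. f x = 0}"
      using U V by blast
    define H where "H = {\<lambda>x. f x * g x | f g. f \<in> F \<and> g \<in> G}"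
    have "H \<subseteq> polynomial_functions C"
      using F(1) G(1) unfolding H_def by (auto intro: polynomial_functions.mult)
    moreover have "(\<forall>h\<in>H. h x = 0) \<longleftrightarrow> (\<forall>f\<in>F. f x = 0) \<or> (\<forall>g\<in>G. g x = 0)" for x
    proof
      assume h: "\<forall>h\<in>H. h x = 0"
      have "f x * g x = 0" if "f \<in> F" "g \<in> G" for f g
      proof -
        have "(\<lambda>x. f x * g x) \<in> H"
          unfolding H_def using that by auto
        with h show ?thesis by (rule bspec)
      qed
      then show "(\<forall>f\<in>F. f x = 0) \<or> (\<forall>g\<in>G. g x = 0)"
        by (metis mult_eq_0_iff)
    qed (auto simp: H_def)
    then have "U \<inter> V = S - {x \<in> S. \<forall>h\<in>H. h x = 0}"
      unfolding F(2) G(2) by blast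
    ultimately show ?thesis by (intro exI[of _ H] conjI)
  qed
  moreover have "?P (\<Union>\<U>)" if "\<forall>U\<in>\<U>. ?P U" for \<U>
  proof -
    from bchoice[OF that] obtain F where F: "\<forall>U\<in>\<U>. F U \<subseteq> polynomial_functions C \<and>
        U = S - {x \<in> S. \<forall>f\<in>F U. f x = 0}" ..
    have "\<Union>\<U> = S - {x \<in> S. \<forall>f\<in>(\<Union>U\<in>\<U>. F U). f x = 0}" (is "_ = ?R")
    proof (rule set_eqI)
      fix x
      have "x \<in> U \<longleftrightarrow> x \<in> S \<and> (\<exists>f\<in>F U. f x \<noteq> 0)" if "U \<in> \<U>" for U
      proof -
        have "U = S - {x \<in> S. \<forall>f\<in>F U. f x = 0}" using F that by blast
        then have "x \<in> U \<longleftrightarrow> x \<in> S - {x \<in> S. \<forall>f\<in>F U. f x = 0}" by (rule arg_cong)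
        then show ?thesis by blast
      qed
      then show "x \<in> \<Union>\<U> \<longleftrightarrow> x \<in> ?R" by blast
    qed
    moreover have "(\<Union>U\<in>\<U>. F U) \<subseteq> polynomial_functions C"
      using F by blast
    ultimately show ?thesis by (intro exI[of _ "\<Union>U\<in>\<U>. F U"] conjI)
  qed
  ultimately show ?thesis
    unfolding istopology_def by (intro conjI allI impI)
qed

lemma openin_zariski:
  "openin (zariski C S) U \<longleftrightarrow>
     (\<exists>F \<subseteq> polynomial_functions C. U = S - {x \<in> S. \<forall>f\<in>F. f x = 0})"
  unfolding zariski_def topology_inverse'[OF istopology_zariski] ..

lemma topspace_zariski [simp]: "topspace (zariski C S) = S"
proof
  show "topspace (zariski C S) \<subseteq> S"
    unfolding topspace_def by (auto simp: openin_zariski)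
  have "openin (zariski C S) S"
    unfolding openin_zariski
    by (rule exI[of _ "{\<lambda>_. 1}"]) (auto intro: polynomial_functions.const)
  then show "S \<subseteq> topspace (zariski C S)"
    by (rule openin_subset)
qed

lemma closedin_zariski:
  "closedin (zariski C S) Z \<longleftrightarrow>
     (\<exists>F \<subseteq> polynomial_functions C. Z = {x \<in> S. \<forall>f\<in>F. f x = 0})"
proof
  assume "closedin (zariski C S) Z"
  then have Z: "Z \<subseteq> S" and "openin (zariski C S) (S - Z)"
    by (simp_all add: closedin_def)
  then obtain F where F: "F \<subseteq> polynomial_functions C" "S - Z = S - {x \<in> S. \<forall>f\<in>F. f x = 0}"
    unfolding openin_zariski by (elim exE conjE)
  have "Z = S - (S - Z)" using Z by blast
  also have "\<dots> = {x \<in> S. \<forall>f\<in>F. f x = 0}" unfolding F(2) by blast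
  finally show "\<exists>F \<subseteq> polynomial_functions C. Z = {x \<in> S. \<forall>f\<in>F. f x = 0}"
    using F(1) by (intro exI[of _ F] conjI)
next
  assume "\<exists>F \<subseteq> polynomial_functions C. Z = {x \<in> S. \<forall>f\<in>F. f x = 0}"
  then obtain F where "F \<subseteq> polynomial_functions C" "Z = {x \<in> S. \<forall>f\<in>F. f x = 0}"
    by (elim exE conjE)
  then show "closedin (zariski C S) Z"
    unfolding closedin_def topspace_zariski openin_zariski
    by (intro conjI exI[of _ F]) (auto simp only:)
qed

definition irreducible_in :: "'a topology \<Rightarrow> 'a set \<Rightarrow> bool" where
  "irreducible_in X S \<longleftrightarrow> S \<subseteq> topspace X \<and> S \<noteq> {} \<and>
     (\<forall>A B. closedin (subtopology X S) A \<and> closedin (subtopology X S) B \<and> S = A \<union> B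
        \<longrightarrow> A = S \<or> B = S)"

definition irreducible_components_of :: "'a topology \<Rightarrow> 'a set set" where
  "irreducible_components_of X =
     {S. irreducible_in X S \<and> (\<forall>T. irreducible_in X T \<and> S \<subseteq> T \<longrightarrow> T = S)}"

type_synonym V = "complex^2"
type_synonym bilmap = "V \<Rightarrow> V \<Rightarrow> V"

text \<open>The library constant \<open>bilinear\<close> means real bilinear; here bilinearity is over the complex
  numbers.\<close>

abbreviation clinear :: "(V \<Rightarrow> V) \<Rightarrow> bool" where
  "clinear \<equiv> Vector_Spaces.linear (*s) (*s)"

definition Bil :: "bilmap set" where
  "Bil = {m. (\<forall>x. clinear (m x)) \<and> (\<forall>y. clinear (\<lambda>x. m x y))}"

definition e1 :: V where "e1 = axis 1 1"
definition e2 :: V where "e2 = axis 2 1"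

text \<open>The 16 coordinates on \<open>Bil \<times> Bil\<close> are the structure constants of the two maps in the basis
  \<open>e1, e2\<close>.\<close>

definition structure_constants :: "(bilmap \<times> bilmap \<Rightarrow> complex) set" where
  "structure_constants =
     {\<lambda>p. fst p a b $ k | a b k. a \<in> {e1, e2} \<and> b \<in> {e1, e2}} \<union>
     {\<lambda>p. snd p a b $ k | a b k. a \<in> {e1, e2} \<and> b \<in> {e1, e2}}"

definition zariski_Bil2 :: "(bilmap \<times> bilmap) topology" where
  "zariski_Bil2 = zariski structure_constants (Bil \<times> Bil)"

definition GL :: "(V \<Rightarrow> V) set" where
  "GL = {g. clinear g \<and> bij g}"

definition act :: "(V \<Rightarrow> V) \<Rightarrow> bilmap \<times> bilmap \<Rightarrow> bilmap \<times> bilmap" where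
  "act g p = (\<lambda>x y. g (fst p (inv g x) (inv g y)), \<lambda>x y. g (snd p (inv g x) (inv g y)))"

definition orbit :: "bilmap \<times> bilmap \<Rightarrow> (bilmap \<times> bilmap) set" where
  "orbit p = {act g p | g. g \<in> GL}"

definition symmetric_leibniz :: "bilmap \<Rightarrow> bool" where
  "symmetric_leibniz b \<longleftrightarrow>
     (\<forall>x y z. b (b x y) z = b (b x z) y + b x (b y z)) \<and>
     (\<forall>x y z. b x (b y z) = b (b x y) z + b y (b x z))"

definition transposed_leibniz_poisson :: "bilmap \<Rightarrow> bilmap \<Rightarrow> bool" where
  "transposed_leibniz_poisson m b \<longleftrightarrow>
     m \<in> Bil \<and> b \<in> Bil \<and>
     (\<forall>x y. m x y = m y x) \<and>
     (\<forall>x y z. m (m x y) z = m x (m y z)) \<and>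
     symmetric_leibniz b \<and>
     (\<forall>x y z. 2 *s m (b x y) z = b (m x z) y + b x (m y z))"

definition TLP :: "(bilmap \<times> bilmap) set" where
  "TLP = {(m, b). transposed_leibniz_poisson m b}"

text \<open>The bilinear map with prescribed values at \<open>(e1,e1)\<close>, \<open>(e1,e2)\<close>, \<open>(e2,e1)\<close>, \<open>(e2,e2)\<close>,
  in this order.\<close>

definition table :: "V \<Rightarrow> V \<Rightarrow> V \<Rightarrow> V \<Rightarrow> bilmap" where
  "table a11 a12 a21 a22 x y =
     (x$1 * y$1) *s a11 + (x$1 * y$2) *s a12 + (x$2 * y$1) *s a21 + (x$2 * y$2) *s a22"

definition T3 :: "bilmap \<times> bilmap" where
  "T3 = (table e1 0 0 e2, table 0 0 0 0)"

definition T4 :: "bilmap \<times> bilmap" where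
  "T4 = (table e1 e2 e2 0, table e2 0 0 0)"

definition T5 :: "complex \<Rightarrow> bilmap \<times> bilmap" where
  "T5 \<alpha> = (table e1 e2 e2 0, table 0 (\<alpha> *s e2) (- \<alpha> *s e2) 0)"

end

theory Submission imports Defs
begin

text \<open>Every algebra of the variety has, in a suitable basis, one of three shapes. If some square
  \<open>w = [u,u]\<close> is nonzero, then \<open>w\<close> annihilates the bracket on both sides and the compatibility
  condition in the basis \<open>u, w\<close> forces \<open>u\<cdot>u = s u + c w\<close>, \<open>u\<cdot>w = s w\<close>, \<open>w\<cdot>w = 0\<close>. If the bracket is
  alternating and nonzero, its image is spanned by one vector \<open>n\<close> and the same shape of product
  results with \<open>n\<close> in place of \<open>w\<close>. If the bracket vanishes, a common eigenvector of the
  multiplications gives either the same shape again or \<open>e\<cdot>e = e\<close>, \<open>e\<cdot>n = 0\<close>, \<open>n\<cdot>n = t n\<close>. For nonzero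
  parameters these structures lie in the orbits of \<open>T4\<close>, of some \<open>T5 \<alpha>\<close>, and of \<open>T3\<close>, respectively;
  perturbing the parameters along a line puts the remaining ones into the closures.

  Irreducibility and closure membership are both tested on curves in one complex parameter, where
  they reduce to a nonzero polynomial in one variable having only finitely many roots. The three
  closures are told apart by the vanishing, symmetry or antisymmetry of the bracket and by the
  discriminant of the multiplication by \<open>e1\<close>.\<close>

subsection \<open>Structure constants and changes of basis\<close>

lemma clinear_iff:
  "clinear f \<longleftrightarrow> (\<forall>x y. f (x + y) = f x + f y) \<and> (\<forall>c x. f (c *s x) = c *s f x)"
  by (auto simp: Vector_Spaces.linear_iff vec.vector_space_axioms)

lemma e_nth [simp]: "e1 $ 1 = 1" "e1 $ 2 = 0" "e2 $ 1 = 0" "e2 $ 2 = 1"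
  by (simp_all add: e1_def e2_def axis_def)

lemma V_eq_iff: "(x::V) = y \<longleftrightarrow> x $ 1 = y $ 1 \<and> x $ 2 = y $ 2"
  by (simp add: vec_eq_iff forall_2)

lemma Bil_iff:
  "m \<in> Bil \<longleftrightarrow> (\<forall>x y z. m (x + y) z = m x z + m y z) \<and> (\<forall>c x z. m (c *s x) z = c *s m x z) \<and>
     (\<forall>x y z. m x (y + z) = m x y + m x z) \<and> (\<forall>c x z. m x (c *s z) = c *s m x z)"
  unfolding Bil_def clinear_iff by blast

lemma BilD:
  assumes "m \<in> Bil"
  shows "m (x + y) z = m x z + m y z" "m (c *s x) z = c *s m x z"
    "m x (y + z) = m x y + m x z" "m x (c *s z) = c *s m x z"
    "m 0 x = 0" "m x 0 = 0"
proof -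
  show *: "m (x + y) z = m x z + m y z" "m (c *s x) z = c *s m x z"
    "m x (y + z) = m x y + m x z" "m x (c *s z) = c *s m x z" for x y z c
    using assms unfolding Bil_iff by blast+
  show "m 0 x = 0" "m x 0 = 0"
    using *(2)[of 0 0 x] *(4)[of x 0 0] by simp_all
qed

lemma table_nth [simp]:
  "table a b c d x y $ k =
     x$1 * y$1 * a$k + x$1 * y$2 * b$k + x$2 * y$1 * c$k + x$2 * y$2 * d$k"
  by (simp add: table_def)

lemma table_in_Bil [simp]: "table a b c d \<in> Bil"
  by (simp add: Bil_iff V_eq_iff algebra_simps)

lemma Bil_expand:
  assumes "m \<in> Bil"
  shows "m (a *s u + b *s w) (c *s u + d *s w) =
    (a * c) *s m u u + (a * d) *s m u w + (b * c) *s m w u + (b * d) *s m w w"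
  using assms by (simp add: Bil_iff V_eq_iff algebra_simps)

lemma Bil_table:
  assumes "m \<in> Bil"
  shows "m = table (m e1 e1) (m e1 e2) (m e2 e1) (m e2 e2)"
proof (intro ext)
  fix x y
  have "x = x$1 *s e1 + x$2 *s e2" "y = y$1 *s e1 + y$2 *s e2"
    by (simp_all add: V_eq_iff)
  then show "m x y = table (m e1 e1) (m e1 e2) (m e2 e1) (m e2 e2) x y"
    unfolding table_def using Bil_expand[OF assms] by metis
qed

lemma Bil_nth:
  assumes "m \<in> Bil"
  shows "m x y $ k = x$1 * y$1 * m e1 e1 $ k + x$1 * y$2 * m e1 e2 $ k +
    x$2 * y$1 * m e2 e1 $ k + x$2 * y$2 * m e2 e2 $ k"
  using Bil_table[OF assms] table_nth by metis

section \<open>Invertible linear maps of the plane as pairs of basis vectors\<close>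

definition vdet :: "V \<Rightarrow> V \<Rightarrow> complex" where
  "vdet u w = u$1 * w$2 - u$2 * w$1"

definition frame :: "V \<Rightarrow> V \<Rightarrow> V \<Rightarrow> V" where
  "frame u w x = x$1 *s u + x$2 *s w"

text \<open>This is the adjugate of the matrix with columns \<open>u\<close> and \<open>w\<close>.
  Unlike the inverse it is polynomial in the entries of \<open>u\<close> and
  \<open>w\<close>.\<close>

definition adj_frame :: "V \<Rightarrow> V \<Rightarrow> V \<Rightarrow> V" where
  "adj_frame u w x = (x$1 * w$2 - x$2 * w$1) *s e1 + (u$1 * x$2 - u$2 * x$1) *s e2"

lemma frame_nth [simp]: "frame u w x $ k = x$1 * u$k + x$2 * w$k"
  by (simp add: frame_def)

lemma adj_frame_nth [simp]:
  "adj_frame u w x $ 1 = x$1 * w$2 - x$2 * w$1" "adj_frame u w x $ 2 = u$1 * x$2 - u$2 * x$1"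
  by (simp_all add: adj_frame_def)

lemma frame_adj: "frame u w (adj_frame u w x) = vdet u w *s x"
  and adj_frame: "adj_frame u w (frame u w x) = vdet u w *s x"
  by (simp_all add: V_eq_iff vdet_def algebra_simps)

lemma adj_frame_scale: "adj_frame u w (c *s x) = c *s adj_frame u w x"
  by (simp add: V_eq_iff algebra_simps)

lemma frame_scale: "frame u w (c *s x) = c *s frame u w x"
  by (simp add: V_eq_iff algebra_simps)

lemma clinear_frame: "clinear (frame u w)"
  by (simp add: clinear_iff V_eq_iff algebra_simps)

lemma bij_frame:
  assumes "vdet u w \<noteq> 0"
  shows "bij (frame u w)"
  by (rule bij_betw_byWitness[where f' = "\<lambda>x. (1 / vdet u w) *s adj_frame u w x"])
    (use assms in \<open>auto simp: adj_frame frame_scale frame_adj\<close>)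

lemma inv_frame:
  assumes "vdet u w \<noteq> 0"
  shows "inv (frame u w) x = (1 / vdet u w) *s adj_frame u w x"
  by (rule inv_f_eq)
    (use bij_frame[OF assms] assms in \<open>auto simp: bij_def frame_scale frame_adj\<close>)

lemma GL_iff: "g \<in> GL \<longleftrightarrow> (\<exists>u w. vdet u w \<noteq> 0 \<and> g = frame u w)"
proof
  assume g: "g \<in> GL"
  have "g x = frame (g e1) (g e2) x" for x
  proof -
    have "g (x$1 *s e1 + x$2 *s e2) = frame (g e1) (g e2) x"
      using g by (simp add: GL_def clinear_iff frame_def)
    moreover have "x$1 *s e1 + x$2 *s e2 = x"
      by (simp add: V_eq_iff)
    ultimately show ?thesis by simp
  qed
  then obtain u w where uw: "g = frame u w"
    by blast
  have inj: "x = 0" if "frame u w x = 0" for x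
  proof -
    have "frame u w 0 = 0" by (simp add: V_eq_iff)
    with that g uw show ?thesis by (metis (no_types, lifting) GL_def bij_def injD mem_Collect_eq)
  qed
  have "vdet u w \<noteq> 0"
  proof
    assume D: "vdet u w = 0"
    \<comment> \<open>Up to sign, this vector and the next are the columns of the adjugate;
      \<open>frame u w\<close> sends them to multiples of the determinant, hence to zero.\<close>
    have "w$2 *s e1 + (- u$2) *s e2 = 0"
      by (rule inj) (use D in \<open>simp add: V_eq_iff vdet_def algebra_simps\<close>)
    moreover have "w$1 *s e1 + (- u$1) *s e2 = 0"
      by (rule inj) (use D in \<open>simp add: V_eq_iff vdet_def algebra_simps\<close>)
    ultimately have "u = 0" "w = 0"
      by (simp_all add: V_eq_iff)
    have "e1 = 0"
      by (rule inj) (simp add: V_eq_iff \<open>u = 0\<close> \<open>w = 0\<close>)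
    then show False by (simp add: V_eq_iff)
  qed
  with uw show "\<exists>u w. vdet u w \<noteq> 0 \<and> g = frame u w" by blast
qed (auto simp: GL_def clinear_frame bij_frame)

lemma frame_in_GL: "vdet u w \<noteq> 0 \<Longrightarrow> frame u w \<in> GL"
  using GL_iff by blast

lemma GL_0: "g \<in> GL \<Longrightarrow> g 0 = 0"
  unfolding GL_iff by (auto simp: V_eq_iff)

lemma GL_uminus: "g \<in> GL \<Longrightarrow> g (- x) = - g x"
  unfolding GL_iff by (auto simp: V_eq_iff)

lemma act_in_Bil:
  assumes "g \<in> GL" "p \<in> Bil \<times> Bil"
  shows "act g p \<in> Bil \<times> Bil"
proof -
  obtain u w where uw: "vdet u w \<noteq> 0" "g = frame u w"
    using assms(1) GL_iff by blast
  have add: "inv g (x + y) = inv g x + inv g y" for x y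
    by (simp add: uw inv_frame V_eq_iff add_divide_distrib diff_divide_distrib algebra_simps)
  have scale: "inv g (c *s x) = c *s inv g x" for c x
    by (simp add: uw inv_frame V_eq_iff diff_divide_distrib algebra_simps)
  have g: "g (x + y) = g x + g y" "g (c *s x) = c *s g x" for x y c
    using assms(1) by (simp_all add: GL_def clinear_iff)
  show ?thesis
    using assms(2) by (cases p) (simp add: act_def Bil_iff add scale g)
qed

lemma TLP_act:
  assumes "g \<in> GL" "p \<in> TLP"
  shows "act g p \<in> TLP"
proof -
  have inv: "inv g (g x) = x" "g (inv g x) = x" for x
    using assms(1) by (auto simp: GL_def bij_def surj_f_inv_f)
  have g: "g (x + y) = g x + g y" "g (c *s x) = c *s g x" for x y c
    using assms(1) by (simp_all add: GL_def clinear_iff)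
  obtain m b where p: "p = (m, b)" by fastforce
  have mb: "transposed_leibniz_poisson m b" using assms(2) p by (simp add: TLP_def)
  then have "act g p \<in> Bil \<times> Bil"
    by (intro act_in_Bil assms(1)) (simp add: p transposed_leibniz_poisson_def)
  then have B: "(\<lambda>x y. g (m (inv g x) (inv g y))) \<in> Bil" "(\<lambda>x y. g (b (inv g x) (inv g y))) \<in> Bil"
    by (simp_all add: act_def p)
  have laws: "m x y = m y x" "m (m x y) z = m x (m y z)"
    "b (b x y) z = b (b x z) y + b x (b y z)" "b x (b y z) = b (b x y) z + b y (b x z)"
    "2 *s m (b x y) z = b (m x z) y + b x (m y z)" for x y z
    using mb unfolding transposed_leibniz_poisson_def symmetric_leibniz_def by blast+
  \<comment> \<open>After \<open>inv g (g x) = x\<close> and linearity of \<open>g\<close>, both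
    sides of every law are \<open>g\<close> applied to the sides of the same law for
    \<open>m\<close> and \<open>b\<close>.\<close>
  show ?thesis
    unfolding p TLP_def act_def transposed_leibniz_poisson_def symmetric_leibniz_def mem_Collect_eq
      prod.case fst_conv snd_conv inv g[symmetric]
    by (intro conjI allI arg_cong[where f = g] B laws)
qed

text \<open>Two bilinear maps that agree on a basis are equal. This recognises a structure as a
  transported table from its products on the basis \<open>u\<close>, \<open>w\<close> alone.\<close>

lemma act_frame_eq:
  assumes "m \<in> Bil" "b \<in> Bil" "vdet u w \<noteq> 0"
    and "m u u = frame u w a11" "m u w = frame u w a12" "m w u = frame u w a21" "m w w = frame u w a22"
    and "b u u = frame u w b11" "b u w = frame u w b12" "b w u = frame u w b21" "b w w = frame u w b22"
  shows "act (frame u w) (table a11 a12 a21 a22, table b11 b12 b21 b22) = (m, b)"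
proof -
  have *: "frame u w (table c11 c12 c21 c22 (inv (frame u w) x) (inv (frame u w) y)) = k x y"
    if "k \<in> Bil" "k u u = frame u w c11" "k u w = frame u w c12" "k w u = frame u w c21"
      "k w w = frame u w c22" for k c11 c12 c21 c22 x y
  proof -
    define x' y' where "x' = inv (frame u w) x" and "y' = inv (frame u w) y"
    have "frame u w x' = x" "frame u w y' = y"
      using bij_frame[OF assms(3)] by (simp_all add: x'_def y'_def bij_def surj_f_inv_f)
    then have "k x y = k (x'$1 *s u + x'$2 *s w) (y'$1 *s u + y'$2 *s w)"
      by (simp add: frame_def)
    also have "\<dots> = frame u w (table c11 c12 c21 c22 x' y')"
      unfolding Bil_expand[OF that(1)] that(2-5) by (simp add: V_eq_iff algebra_simps)
    finally show ?thesis by (simp add: x'_def y'_def)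
  qed
  show ?thesis
    using assms by (simp add: act_def * fun_eq_iff)
qed

lemma T3_in_TLP: "T3 \<in> TLP"
  by (simp add: T3_def TLP_def transposed_leibniz_poisson_def symmetric_leibniz_def V_eq_iff)

lemma T4_in_TLP: "T4 \<in> TLP"
  by (simp add: T4_def TLP_def transposed_leibniz_poisson_def symmetric_leibniz_def V_eq_iff
      algebra_simps)

lemma T5_in_TLP: "T5 \<alpha> \<in> TLP"
  by (simp add: T5_def TLP_def transposed_leibniz_poisson_def symmetric_leibniz_def V_eq_iff
      algebra_simps)

subsection \<open>Polynomials in one variable\<close>

definition univ_poly :: "(complex \<Rightarrow> complex) \<Rightarrow> bool" where
  "univ_poly f \<longleftrightarrow> (\<exists>P. f = poly P)"

lemma univ_poly_const [intro, simp]: "univ_poly (\<lambda>_. c)"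
  unfolding univ_poly_def by (rule exI[of _ "[:c:]"]) auto

lemma univ_poly_ident [intro, simp]: "univ_poly (\<lambda>t. t)"
  unfolding univ_poly_def by (rule exI[of _ "[:0, 1:]"]) auto

lemma univ_poly_add [intro, simp]:
  assumes "univ_poly f" "univ_poly g" shows "univ_poly (\<lambda>t. f t + g t)"
proof -
  obtain P Q where "f = poly P" "g = poly Q" using assms univ_poly_def by blast
  then show ?thesis unfolding univ_poly_def by (intro exI[of _ "P + Q"]) auto
qed

lemma univ_poly_mult [intro, simp]:
  assumes "univ_poly f" "univ_poly g" shows "univ_poly (\<lambda>t. f t * g t)"
proof -
  obtain P Q where "f = poly P" "g = poly Q" using assms univ_poly_def by blast
  then show ?thesis unfolding univ_poly_def by (intro exI[of _ "P * Q"]) auto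
qed

lemma univ_poly_uminus [intro, simp]: "univ_poly f \<Longrightarrow> univ_poly (\<lambda>t. - f t)"
  using univ_poly_mult[of "\<lambda>_. -1" f] by simp

lemma univ_poly_diff [intro, simp]:
  "univ_poly f \<Longrightarrow> univ_poly g \<Longrightarrow> univ_poly (\<lambda>t. f t - g t)"
  using univ_poly_add[of f "\<lambda>t. - g t"] by simp

lemma univ_poly_compose:
  assumes "univ_poly f" "univ_poly g" shows "univ_poly (\<lambda>t. f (g t))"
proof -
  obtain P Q where "f = poly P" "g = poly Q" using assms univ_poly_def by blast
  then show ?thesis unfolding univ_poly_def by (intro exI[of _ "P \<circ>\<^sub>p Q"]) (auto simp: poly_pcompose)
qed

text \<open>The polynomial ring has no zero divisors, and over an infinite field a nonzero
  polynomial is a nonzero function. In effect this is the irreducibility of the affine line.\<close>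

lemma univ_poly_common_nonzero:
  assumes "univ_poly f" "univ_poly g" "f a \<noteq> 0" "g b \<noteq> 0"
  shows "\<exists>t. f t \<noteq> 0 \<and> g t \<noteq> 0"
proof -
  obtain P Q where PQ: "f = poly P" "g = poly Q" using assms univ_poly_def by blast
  with assms have "P * Q \<noteq> 0" by auto
  then obtain t where "poly (P * Q) t \<noteq> 0" using poly_all_0_iff_0 by blast
  with PQ show ?thesis by auto
qed

subsection \<open>Regular functions\<close>

text \<open>\<open>polynomial_functions\<close> are functions on all pairs of maps, whereas \<open>p \<mapsto> fst p x y $ k\<close> agrees with a
  polynomial in the structure constants only at bilinear pairs.\<close>

definition regular :: "(bilmap \<times> bilmap \<Rightarrow> complex) \<Rightarrow> bool" where
  "regular f \<longleftrightarrow> (\<exists>h\<in>polynomial_functions structure_constants. \<forall>p\<in>Bil \<times> Bil. f p = h p)"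

lemma regular_const [intro, simp]: "regular (\<lambda>_. c)"
  unfolding regular_def by (auto intro: polynomial_functions.const)

lemma regular_add [intro, simp]:
  assumes "regular f" "regular g" shows "regular (\<lambda>p. f p + g p)"
proof -
  obtain f' g' where "f' \<in> polynomial_functions structure_constants" "\<forall>p\<in>Bil \<times> Bil. f p = f' p"
    "g' \<in> polynomial_functions structure_constants" "\<forall>p\<in>Bil \<times> Bil. g p = g' p"
    using assms unfolding regular_def by blast
  then show ?thesis
    unfolding regular_def by (intro bexI[of _ "\<lambda>p. f' p + g' p"] polynomial_functions.add) auto
qed

lemma regular_mult [intro, simp]:
  assumes "regular f" "regular g" shows "regular (\<lambda>p. f p * g p)"
proof -
  obtain f' g' where "f' \<in> polynomial_functions structure_constants" "\<forall>p\<in>Bil \<times> Bil. f p = f' p"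
    "g' \<in> polynomial_functions structure_constants" "\<forall>p\<in>Bil \<times> Bil. g p = g' p"
    using assms unfolding regular_def by blast
  then show ?thesis
    unfolding regular_def by (intro bexI[of _ "\<lambda>p. f' p * g' p"] polynomial_functions.mult) auto
qed

lemma regular_diff [intro, simp]:
  assumes "regular f" "regular g" shows "regular (\<lambda>p. f p - g p)"
  using regular_add[OF assms(1) regular_mult[OF regular_const[of "-1"] assms(2)]] by simp

lemma regular_cong: "regular g \<Longrightarrow> (\<And>p. p \<in> Bil \<times> Bil \<Longrightarrow> f p = g p) \<Longrightarrow> regular f"
  unfolding regular_def by auto

lemma regular_coord:
  assumes "a \<in> {e1, e2}" "b \<in> {e1, e2}"
  shows "regular (\<lambda>p. fst p a b $ k)" "regular (\<lambda>p. snd p a b $ k)"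
proof -
  have "(\<lambda>p. fst p a b $ k) \<in> structure_constants" "(\<lambda>p. snd p a b $ k) \<in> structure_constants"
    using assms unfolding structure_constants_def by blast+
  then show "regular (\<lambda>p. fst p a b $ k)" "regular (\<lambda>p. snd p a b $ k)"
    unfolding regular_def by (metis polynomial_functions.coord)+
qed

text \<open>The arguments may depend on \<open>p\<close> themselves, so iterated products such as
  those in associativity are covered. The expansion in structure constants is valid because only
  bilinear pairs count.\<close>

lemma regular_apply [intro, simp]:
  assumes "\<And>i. regular (\<lambda>p. x p $ i)" "\<And>i. regular (\<lambda>p. y p $ i)"
  shows "regular (\<lambda>p. fst p (x p) (y p) $ k)" "regular (\<lambda>p. snd p (x p) (y p) $ k)"
proof -
  have "regular (\<lambda>p. x p $ 1 * y p $ 1 * fst p e1 e1 $ k + x p $ 1 * y p $ 2 * fst p e1 e2 $ k +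
      x p $ 2 * y p $ 1 * fst p e2 e1 $ k + x p $ 2 * y p $ 2 * fst p e2 e2 $ k)"
    by (intro regular_add regular_mult assms regular_coord) simp_all
  then show "regular (\<lambda>p. fst p (x p) (y p) $ k)"
    by (rule regular_cong) (rule Bil_nth, auto)
  have "regular (\<lambda>p. x p $ 1 * y p $ 1 * snd p e1 e1 $ k + x p $ 1 * y p $ 2 * snd p e1 e2 $ k +
      x p $ 2 * y p $ 1 * snd p e2 e1 $ k + x p $ 2 * y p $ 2 * snd p e2 e2 $ k)"
    by (intro regular_add regular_mult assms regular_coord) simp_all
  then show "regular (\<lambda>p. snd p (x p) (y p) $ k)"
    by (rule regular_cong) (rule Bil_nth, auto)
qed

lemma topspace_zariski_Bil2 [simp]: "topspace zariski_Bil2 = Bil \<times> Bil"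
  by (simp add: zariski_Bil2_def)

lemma closedin_zariski_Bil2I:
  assumes "\<And>f. f \<in> F \<Longrightarrow> regular f"
  shows "closedin zariski_Bil2 {p \<in> Bil \<times> Bil. \<forall>f\<in>F. f p = 0}"
proof -
  have "\<forall>f\<in>F. \<exists>h. h \<in> polynomial_functions structure_constants \<and> (\<forall>p\<in>Bil \<times> Bil. f p = h p)"
    using assms unfolding regular_def by blast
  from bchoice[OF this] obtain h where h: "\<forall>f\<in>F. h f \<in> polynomial_functions structure_constants \<and>
    (\<forall>p\<in>Bil \<times> Bil. f p = h f p)" ..
  show ?thesis
    unfolding zariski_Bil2_def closedin_zariski
    by (rule exI[of _ "h ` F"]) (use h in auto)
qed

lemma regular_zero_closure:
  assumes "p \<in> zariski_Bil2 closure_of S" "regular f" "\<And>q. q \<in> S \<Longrightarrow> f q = 0" "S \<subseteq> Bil \<times> Bil"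
  shows "f p = 0"
proof -
  have "closedin zariski_Bil2 {p \<in> Bil \<times> Bil. \<forall>f\<in>{f}. f p = 0}"
    by (rule closedin_zariski_Bil2I) (use assms(2) in auto)
  moreover have "S \<subseteq> {p \<in> Bil \<times> Bil. \<forall>f\<in>{f}. f p = 0}"
    using assms(3,4) by auto
  ultimately show ?thesis
    using closure_of_minimal assms(1) by blast
qed

text \<open>For fixed vectors and a fixed coordinate, each axiom says that one regular function
  vanishes. The family of all of them may be infinite, so there is no need to reduce the axioms to
  basis vectors.\<close>

lemma closedin_TLP: "closedin zariski_Bil2 TLP"
proof -
  define F :: "(bilmap \<times> bilmap \<Rightarrow> complex) set" where "F =
    (\<Union>x y k. {\<lambda>p. fst p x y $ k - fst p y x $ k}) \<union>
    (\<Union>x y z k. {\<lambda>p. fst p (fst p x y) z $ k - fst p x (fst p y z) $ k,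
      \<lambda>p. snd p (snd p x y) z $ k - (snd p (snd p x z) y $ k + snd p x (snd p y z) $ k),
      \<lambda>p. snd p x (snd p y z) $ k - (snd p (snd p x y) z $ k + snd p y (snd p x z) $ k),
      \<lambda>p. 2 * fst p (snd p x y) z $ k - (snd p (fst p x z) y $ k + snd p x (fst p y z) $ k)})"
  have "regular f" if "f \<in> F" for f
    using that unfolding F_def by (elim UnE UN_E insertE emptyE) simp_all
  then have "closedin zariski_Bil2 {p \<in> Bil \<times> Bil. \<forall>f\<in>F. f p = 0}"
    by (rule closedin_zariski_Bil2I)
  also have "{p \<in> Bil \<times> Bil. \<forall>f\<in>F. f p = 0} = TLP"
  proof -
    have zero_iff: "(\<forall>f\<in>F. f (m, b) = 0) \<longleftrightarrow> (\<forall>x y. m x y = m y x) \<and>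
      (\<forall>x y z. m (m x y) z = m x (m y z) \<and>
        b (b x y) z = b (b x z) y + b x (b y z) \<and> b x (b y z) = b (b x y) z + b y (b x z) \<and>
        2 *s m (b x y) z = b (m x z) y + b x (m y z))" for m b
      unfolding F_def vec_eq_iff vector_add_component vector_smult_component ball_Un ball_UN
        ball_simps fst_conv snd_conv right_minus_eq by blast
    show ?thesis
      unfolding TLP_def transposed_leibniz_poisson_def symmetric_leibniz_def set_eq_iff
        split_paired_All mem_Collect_eq zero_iff prod.case mem_Times_iff fst_conv snd_conv
      by (simp only: all_conj_distrib conj_ac simp_thms)
  qed
  finally show ?thesis .
qed

subsection \<open>Curves and irreducibility\<close>

definition curve :: "(complex \<Rightarrow> bilmap \<times> bilmap) \<Rightarrow> bool" where
  "curve \<gamma> \<longleftrightarrow> (\<forall>t. \<gamma> t \<in> Bil \<times> Bil) \<and>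
     (\<forall>x y k. univ_poly (\<lambda>t. fst (\<gamma> t) x y $ k) \<and> univ_poly (\<lambda>t. snd (\<gamma> t) x y $ k))"

lemma curve_polynomial:
  assumes "curve \<gamma>" "f \<in> polynomial_functions structure_constants"
  shows "univ_poly (\<lambda>t. f (\<gamma> t))"
  using assms(2)
proof induction
  case (coord f)
  then show ?case using assms(1) by (auto simp: structure_constants_def curve_def)
qed auto

text \<open>A polynomial that vanishes on \<open>S\<close> vanishes along the curve wherever
  \<open>D\<close> is nonzero, hence identically. The zeros of \<open>D\<close> are the parameters
  at which the curve may leave \<open>S\<close>.\<close>

lemma curve_in_closure:
  assumes "curve \<gamma>" "univ_poly D" "D a \<noteq> 0" "\<And>t. D t \<noteq> 0 \<Longrightarrow> \<gamma> t \<in> S"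
    and "S \<subseteq> Bil \<times> Bil"
  shows "\<gamma> t \<in> zariski_Bil2 closure_of S"
proof -
  have "\<gamma> t \<in> Z" if Z: "closedin zariski_Bil2 Z" "S \<subseteq> Z" for Z
  proof -
    obtain F where F: "F \<subseteq> polynomial_functions structure_constants"
      "Z = {p \<in> Bil \<times> Bil. \<forall>f\<in>F. f p = 0}"
      using Z(1) unfolding zariski_Bil2_def closedin_zariski by blast
    have "f (\<gamma> t) = 0" if "f \<in> F" for f
    proof (rule ccontr)
      assume "f (\<gamma> t) \<noteq> 0"
      moreover have "univ_poly (\<lambda>t. f (\<gamma> t))"
        using curve_polynomial assms(1) F(1) that by blast
      ultimately obtain t' where "f (\<gamma> t') \<noteq> 0" "D t' \<noteq> 0"
        using univ_poly_common_nonzero[of "\<lambda>t. f (\<gamma> t)" D] assms(2,3) by blast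
      with assms(4) Z(2) F(2) that show False by blast
    qed
    then show ?thesis using F(2) assms(1) by (auto simp: curve_def)
  qed
  then show ?thesis
    using assms(5) by (simp add: closure_of_subset)
qed

section \<open>Irreducible sets and components\<close>

lemma irreducible_in_iff:
  "irreducible_in X S \<longleftrightarrow> S \<subseteq> topspace X \<and> S \<noteq> {} \<and>
     (\<forall>A B. closedin X A \<and> closedin X B \<and> S \<subseteq> A \<union> B \<longrightarrow> S \<subseteq> A \<or> S \<subseteq> B)"
proof -
  have *: "(\<forall>A B. closedin (subtopology X S) A \<and> closedin (subtopology X S) B \<and> S = A \<union> B
      \<longrightarrow> A = S \<or> B = S) \<longleftrightarrow>
    (\<forall>A B. closedin X A \<and> closedin X B \<and> S \<subseteq> A \<union> B \<longrightarrow> S \<subseteq> A \<or> S \<subseteq> B)" (is "?L \<longleftrightarrow> ?R")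
  proof
    assume L: ?L
    show ?R
    proof (intro allI impI, elim conjE)
      fix A B assume "closedin X A" "closedin X B" "S \<subseteq> A \<union> B"
      then have "closedin (subtopology X S) (A \<inter> S)" "closedin (subtopology X S) (B \<inter> S)"
        "S = (A \<inter> S) \<union> (B \<inter> S)"
        by (auto simp: closedin_subtopology)
      with L show "S \<subseteq> A \<or> S \<subseteq> B" by blast
    qed
  next
    assume R: ?R
    show ?L
    proof (intro allI impI, elim conjE)
      fix A B
      assume cl: "closedin (subtopology X S) A" "closedin (subtopology X S) B" and AB: "S = A \<union> B"
      from cl obtain A' B' where "closedin X A'" "A = A' \<inter> S" "closedin X B'" "B = B' \<inter> S"
        unfolding closedin_subtopology by blast
      moreover from this AB have "S \<subseteq> A' \<union> B'" by blast
      ultimately show "A = S \<or> B = S" using R by blast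
    qed
  qed
  show ?thesis unfolding irreducible_in_def * ..
qed

lemma irreducible_in_Union:
  assumes "irreducible_in X T" "finite \<C>" "\<And>C. C \<in> \<C> \<Longrightarrow> closedin X C" "T \<subseteq> \<Union>\<C>"
  shows "\<exists>C\<in>\<C>. T \<subseteq> C"
  using assms(2-4)
proof (induction rule: finite_induct)
  case empty
  then show ?case using assms(1) by (auto simp: irreducible_in_iff)
next
  case (insert C \<C>)
  have "closedin X (\<Union>\<C>)"
    using insert by (intro closedin_Union) auto
  then have "T \<subseteq> C \<or> T \<subseteq> \<Union>\<C>"
    using assms(1) insert.prems unfolding irreducible_in_iff by simp
  then show ?case using insert by blast
qed

text \<open>An irreducible set covered by finitely many closed sets lies in one of them, so a
  maximal one is a member of the cover; the absence of inclusions makes each member maximal.\<close>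

lemma irreducible_components_of_eqI:
  assumes "finite \<C>" "\<And>C. C \<in> \<C> \<Longrightarrow> irreducible_in X C" "\<And>C. C \<in> \<C> \<Longrightarrow> closedin X C"
    and cover: "topspace X \<subseteq> \<Union>\<C>"
    and antichain: "\<And>C D. C \<in> \<C> \<Longrightarrow> D \<in> \<C> \<Longrightarrow> C \<subseteq> D \<Longrightarrow> C = D"
  shows "irreducible_components_of X = \<C>"
proof -
  have sub: "\<exists>C\<in>\<C>. T \<subseteq> C" if "irreducible_in X T" for T
    using irreducible_in_Union[OF that assms(1,3)] that cover
    unfolding irreducible_in_iff by blast
  show ?thesis
  proof
    show "irreducible_components_of X \<subseteq> \<C>"
      using sub assms(2) unfolding irreducible_components_of_def by blast
    show "\<C> \<subseteq> irreducible_components_of X"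
      using sub assms(2) antichain unfolding irreducible_components_of_def by blast
  qed
qed

text \<open>If \<open>S\<close> met the complements of two closed sets in \<open>p\<close> and
  \<open>q\<close>, a curve from \<open>p\<close> to \<open>q\<close> would, at a generic parameter,
  give a point of \<open>S\<close> outside both. The curve has to stay in \<open>S\<close> only
  where \<open>D\<close> is nonzero.\<close>

lemma irreducible_closureI:
  assumes "S \<noteq> {}" "S \<subseteq> TLP"
    and join: "\<And>p q. p \<in> S \<Longrightarrow> q \<in> S \<Longrightarrow> \<exists>\<gamma> D. curve \<gamma> \<and> univ_poly D \<and> D 0 \<noteq> 0 \<and>
       \<gamma> 0 = p \<and> \<gamma> 1 = q \<and> (\<forall>t. D t \<noteq> 0 \<longrightarrow> \<gamma> t \<in> S)"
  shows "irreducible_in (subtopology zariski_Bil2 TLP) (zariski_Bil2 closure_of S)"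
  unfolding irreducible_in_iff
proof (intro conjI allI impI, goal_cases)
  case 1
  then show ?case
    using closure_of_minimal[OF assms(2) closedin_TLP] closedin_subset[OF closedin_TLP] by auto
next
  case 2
  have "S \<subseteq> topspace zariski_Bil2"
    using assms(2) closedin_subset[OF closedin_TLP] by blast
  then show ?case
    using assms(1) closure_of_subset by blast
next
  case (3 A B)
  then have AB: "closedin zariski_Bil2 A" "closedin zariski_Bil2 B"
    using closedin_closed_subtopology[OF closedin_TLP] by blast+
  obtain F where F: "F \<subseteq> polynomial_functions structure_constants"
    "A = {p \<in> Bil \<times> Bil. \<forall>f\<in>F. f p = 0}"
    using AB(1) unfolding zariski_Bil2_def closedin_zariski by blast
  obtain G where G: "G \<subseteq> polynomial_functions structure_constants"
    "B = {p \<in> Bil \<times> Bil. \<forall>f\<in>G. f p = 0}"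
    using AB(2) unfolding zariski_Bil2_def closedin_zariski by blast
  have S: "S \<subseteq> Bil \<times> Bil" "S \<subseteq> A \<union> B"
    using assms(2) closedin_subset[OF closedin_TLP] 3 closure_of_subset[of S zariski_Bil2]
    by auto
  have "S \<subseteq> A \<or> S \<subseteq> B"
  proof (rule ccontr)
    assume "\<not> (S \<subseteq> A \<or> S \<subseteq> B)"
    then obtain p q f g where pq: "p \<in> S" "f \<in> F" "f p \<noteq> 0" "q \<in> S" "g \<in> G" "g q \<noteq> 0"
      using F(2) G(2) S(1) by blast
    then obtain \<gamma> D where \<gamma>: "curve \<gamma>" "univ_poly D" "D 0 \<noteq> 0" "\<gamma> 0 = p" "\<gamma> 1 = q"
      "\<And>t. D t \<noteq> 0 \<Longrightarrow> \<gamma> t \<in> S"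
      using join[of p q] by blast
    have up: "univ_poly (\<lambda>t. f (\<gamma> t))" "univ_poly (\<lambda>t. g (\<gamma> t))"
      using curve_polynomial \<gamma>(1) F(1) G(1) pq by blast+
    \<comment> \<open>Three polynomials must be nonzero at once: \<open>f\<close> and
      \<open>D\<close> are both nonzero at the parameter 0, so their product is too, and
      \<open>g\<close> is nonzero at 1.\<close>
    have "\<exists>t. f (\<gamma> t) * D t \<noteq> 0 \<and> g (\<gamma> t) \<noteq> 0"
      by (rule univ_poly_common_nonzero[of _ _ 0 1]) (use up \<gamma> pq in auto)
    then obtain t where "f (\<gamma> t) \<noteq> 0" "D t \<noteq> 0" "g (\<gamma> t) \<noteq> 0" by auto
    then show False using \<gamma>(6) S(2) F(2) G(2) pq by blast
  qed
  then show ?case using closure_of_minimal AB by blast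
qed

subsection \<open>Orbits and their closures\<close>

text \<open>The adjugate in place of the inverse makes the orbit map polynomial; the missing scalar is
  recovered because orbits are invariant under scaling.\<close>

definition scaled_act :: "complex \<Rightarrow> V \<Rightarrow> V \<Rightarrow> bilmap \<times> bilmap \<Rightarrow> bilmap \<times> bilmap" where
  "scaled_act \<kappa> u w p =
     (\<lambda>x y. \<kappa> *s frame u w (fst p (adj_frame u w x) (adj_frame u w y)),
      \<lambda>x y. \<kappa> *s frame u w (snd p (adj_frame u w x) (adj_frame u w y)))"

lemma Bil_scale:
  assumes "m \<in> Bil"
  shows "m (c *s x) (d *s y) = (c * d) *s m x y"
  using assms by (simp add: Bil_iff V_eq_iff)

lemma act_frame:
  assumes "vdet u w \<noteq> 0" "p \<in> Bil \<times> Bil"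
  shows "act (frame u w) p = scaled_act (1 / (vdet u w)\<^sup>2) u w p"
proof -
  have "fst p \<in> Bil" "snd p \<in> Bil" using assms(2) by auto
  then show ?thesis
    unfolding act_def scaled_act_def
    by (simp add: inv_frame[OF assms(1)] Bil_scale frame_scale power2_eq_square)
qed

lemma scaled_act_in_orbit:
  assumes "\<kappa> \<noteq> 0" "vdet u w \<noteq> 0" "p \<in> Bil \<times> Bil"
  shows "scaled_act \<kappa> u w p \<in> orbit p"
proof -
  \<comment> \<open>Scaling the basis by \<open>c\<close> gives \<open>c^3\<close> from the frame
    and two adjugates, and \<open>c^(-4)\<close> from the squared determinant. The net factor
    \<open>1/c\<close>, divided by the squared determinant of \<open>u\<close>, \<open>w\<close>,
    has to be \<kappa>.\<close>
  define c where "c = 1 / (\<kappa> * (vdet u w)\<^sup>2)"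
  have [simp]: "c \<noteq> 0" using assms by (simp add: c_def)
  have D: "vdet (c *s u) (c *s w) = c\<^sup>2 * vdet u w"
    by (simp add: vdet_def power2_eq_square algebra_simps)
  have fr: "frame (c *s u) (c *s w) x = c *s frame u w x"
    "adj_frame (c *s u) (c *s w) x = c *s adj_frame u w x" for x
    by (simp_all add: V_eq_iff algebra_simps)
  have coeff: "1 / (c\<^sup>2 * vdet u w)\<^sup>2 * (c * (c * c)) = \<kappa>"
    using assms(1,2) by (simp add: c_def field_simps power2_eq_square)
  have p: "fst p \<in> Bil" "snd p \<in> Bil" using assms(3) by auto
  have D0: "vdet (c *s u) (c *s w) \<noteq> 0" using assms(2) by (simp add: D)
  have "act (frame (c *s u) (c *s w)) p = scaled_act \<kappa> u w p"
    unfolding act_frame[OF D0 assms(3)] unfolding scaled_act_def fr D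
    by (simp only: Bil_scale[OF p(1)] Bil_scale[OF p(2)] frame_scale vector_smult_assoc coeff)
  moreover have "frame (c *s u) (c *s w) \<in> GL"
    using D0 GL_iff by blast
  ultimately show ?thesis unfolding orbit_def by (metis (mono_tags, lifting) mem_Collect_eq)
qed

lemma scaled_act_in_Bil:
  assumes "p \<in> Bil \<times> Bil"
  shows "scaled_act \<kappa> u w p \<in> Bil \<times> Bil"
proof -
  have adj: "adj_frame u w (x + y) = adj_frame u w x + adj_frame u w y"
    "frame u w (x + y) = frame u w x + frame u w y" for x y
    by (simp_all add: V_eq_iff algebra_simps)
  show ?thesis
    using assms
    by (cases p) (simp add: scaled_act_def Bil_iff adj adj_frame_scale frame_scale
        vector_add_ldistrib mult.commute)
qed

lemma curve_scaled_act:
  assumes "curve F" "univ_poly \<kappa>" "\<And>k. univ_poly (\<lambda>t. u t $ k)" "\<And>k. univ_poly (\<lambda>t. w t $ k)"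
  shows "curve (\<lambda>t. scaled_act (\<kappa> t) (u t) (w t) (F t))"
proof -
  have F: "F t \<in> Bil \<times> Bil" "fst (F t) \<in> Bil" "snd (F t) \<in> Bil" for t
    using assms(1) by (auto simp: curve_def mem_Times_iff)
  have up: "univ_poly (\<lambda>t. fst (F t) x y $ k)" "univ_poly (\<lambda>t. snd (F t) x y $ k)" for x y k
    using assms(1) by (auto simp: curve_def)
  \<comment> \<open>The maps in \<open>F t\<close> are applied to vectors that move with
    \<open>t\<close>, so their values are first expanded in structure constants.\<close>
  show ?thesis
    unfolding curve_def
    by (intro conjI allI scaled_act_in_Bil F(1))
      (simp_all add: scaled_act_def Bil_nth[OF F(2), where x = "adj_frame a b v" for a b v]
        Bil_nth[OF F(3), where x = "adj_frame a b v" for a b v] assms up)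
qed

lemma curve_table:
  assumes "\<And>k. univ_poly (\<lambda>t. a11 t $ k)" "\<And>k. univ_poly (\<lambda>t. a12 t $ k)"
    "\<And>k. univ_poly (\<lambda>t. a21 t $ k)" "\<And>k. univ_poly (\<lambda>t. a22 t $ k)"
    "\<And>k. univ_poly (\<lambda>t. b11 t $ k)" "\<And>k. univ_poly (\<lambda>t. b12 t $ k)"
    "\<And>k. univ_poly (\<lambda>t. b21 t $ k)" "\<And>k. univ_poly (\<lambda>t. b22 t $ k)"
  shows "curve (\<lambda>t. (table (a11 t) (a12 t) (a21 t) (a22 t), table (b11 t) (b12 t) (b21 t) (b22 t)))"
  by (simp add: curve_def assms)

lemma curve_compose:
  assumes "curve F" "univ_poly h"
  shows "curve (\<lambda>t. F (h t))"
  using assms(1) univ_poly_compose[OF _ assms(2)] unfolding curve_def by blast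

lemma orbit_subset_TLP:
  assumes "p \<in> TLP" shows "orbit p \<subseteq> TLP"
  using TLP_act[OF _ assms] unfolding orbit_def by blast

lemma TLP_subset_Bil: "TLP \<subseteq> Bil \<times> Bil"
  using closedin_subset[OF closedin_TLP] by simp

lemma self_in_orbit: "p \<in> orbit p"
proof -
  have "act id p = p" by (simp add: act_def)
  moreover have "id \<in> GL" by (simp add: GL_def clinear_iff)
  ultimately show ?thesis unfolding orbit_def by (metis (mono_tags, lifting) mem_Collect_eq)
qed

lemma orbit_act:
  assumes "q \<in> orbit p" "g \<in> GL"
  shows "act g q \<in> orbit p"
proof -
  obtain h where h: "h \<in> GL" "q = act h p"
    using assms(1) unfolding orbit_def by blast
  then have "act g q = act (g \<circ> h) p"
    using assms(2) by (simp add: act_def GL_def o_inv_distrib)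
  moreover have "g \<circ> h \<in> GL"
    using h(1) assms(2) by (simp add: GL_def clinear_iff bij_comp)
  ultimately show ?thesis unfolding orbit_def by blast
qed

text \<open>A point of the union is given by a parameter, two basis vectors and a scalar. Joining
  these data by straight lines joins any two points. A constant family \<open>F\<close> covers the
  case of a single orbit.\<close>

lemma irreducible_closure_orbits:
  assumes "curve F" "\<And>\<alpha>. F \<alpha> \<in> TLP"
  shows "irreducible_in (subtopology zariski_Bil2 TLP)
    (zariski_Bil2 closure_of (\<Union>\<alpha>. orbit (F \<alpha>)))"
proof (rule irreducible_closureI)
  show "(\<Union>\<alpha>. orbit (F \<alpha>)) \<noteq> {}" using self_in_orbit by blast
  show "(\<Union>\<alpha>. orbit (F \<alpha>)) \<subseteq> TLP" using orbit_subset_TLP assms(2) by blast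
next
  fix p q
  assume pq: "p \<in> (\<Union>\<alpha>. orbit (F \<alpha>))" "q \<in> (\<Union>\<alpha>. orbit (F \<alpha>))"
  have "\<exists>\<alpha> u w. vdet u w \<noteq> 0 \<and> p = scaled_act (1 / (vdet u w)\<^sup>2) u w (F \<alpha>)"
    if "p \<in> (\<Union>\<alpha>. orbit (F \<alpha>))" for p
  proof -
    obtain \<alpha> g where "g \<in> GL" "p = act g (F \<alpha>)"
      using \<open>p \<in> (\<Union>\<alpha>. orbit (F \<alpha>))\<close> unfolding orbit_def by blast
    moreover have "F \<alpha> \<in> Bil \<times> Bil" using assms(2) TLP_subset_Bil by blast
    ultimately obtain u w where "vdet u w \<noteq> 0" "p = scaled_act (1 / (vdet u w)\<^sup>2) u w (F \<alpha>)"
      unfolding GL_iff by (metis act_frame)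
    then show ?thesis by blast
  qed
  with pq obtain \<alpha> u w \<alpha>' u' w' where
    p: "vdet u w \<noteq> 0" "p = scaled_act (1 / (vdet u w)\<^sup>2) u w (F \<alpha>)" and
    q: "vdet u' w' \<noteq> 0" "q = scaled_act (1 / (vdet u' w')\<^sup>2) u' w' (F \<alpha>')"
    by meson
  define line :: "complex \<Rightarrow> complex \<Rightarrow> complex \<Rightarrow> complex" where
    "line = (\<lambda>a b t. a + t * (b - a))"
  define vline :: "V \<Rightarrow> V \<Rightarrow> complex \<Rightarrow> V" where
    "vline = (\<lambda>a b t. a + t *s (b - a))"
  have line [simp]: "line a b 0 = a" "line a b 1 = b" "univ_poly (line a b)"
    "vline x y 0 = x" "vline x y 1 = y" "univ_poly (\<lambda>t. vline x y t $ k)" for a b x y k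
    by (simp_all add: line_def vline_def)
  define \<kappa> where "\<kappa> = line (1 / (vdet u w)\<^sup>2) (1 / (vdet u' w')\<^sup>2)"
  define U where "U = vline u u'"
  define W where "W = vline w w'"
  define A where "A = line \<alpha> \<alpha>'"
  define \<gamma> where "\<gamma> = (\<lambda>t. scaled_act (\<kappa> t) (U t) (W t) (F (A t)))"
  \<comment> \<open>The interpolated point can leave the orbit only when the scalar or the
    determinant vanishes.\<close>
  define D where "D = (\<lambda>t. \<kappa> t * vdet (U t) (W t))"
  have "curve \<gamma>" unfolding \<gamma>_def
    by (intro curve_scaled_act curve_compose[OF assms(1)]) (simp_all add: \<kappa>_def U_def W_def A_def)
  moreover have "univ_poly D"
    by (simp add: D_def vdet_def \<kappa>_def U_def W_def)
  moreover have "D 0 \<noteq> 0" "\<gamma> 0 = p" "\<gamma> 1 = q"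
    using p q by (simp_all add: D_def \<gamma>_def \<kappa>_def U_def W_def A_def)
  moreover have "\<gamma> t \<in> (\<Union>\<alpha>. orbit (F \<alpha>))" if "D t \<noteq> 0" for t
  proof -
    have "F (A t) \<in> Bil \<times> Bil" using assms(2) TLP_subset_Bil by blast
    then have "\<gamma> t \<in> orbit (F (A t))"
      unfolding \<gamma>_def by (intro scaled_act_in_orbit) (use that in \<open>auto simp: D_def\<close>)
    then show ?thesis by blast
  qed
  ultimately show "\<exists>\<gamma> D. curve \<gamma> \<and> univ_poly D \<and> D 0 \<noteq> 0 \<and> \<gamma> 0 = p \<and> \<gamma> 1 = q \<and>
      (\<forall>t. D t \<noteq> 0 \<longrightarrow> \<gamma> t \<in> (\<Union>\<alpha>. orbit (F \<alpha>)))"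
    by blast
qed

section \<open>Normal forms and their degenerations\<close>

definition nf_idem :: "complex \<Rightarrow> bilmap \<times> bilmap" where
  "nf_idem t = (table e1 0 0 (t *s e2), table 0 0 0 0)"

definition nf_sym :: "complex \<Rightarrow> complex \<Rightarrow> complex \<Rightarrow> bilmap \<times> bilmap" where
  "nf_sym s c d = (table (s *s e1 + c *s e2) (s *s e2) (s *s e2) 0, table (d *s e2) 0 0 0)"

definition nf_alt :: "complex \<Rightarrow> complex \<Rightarrow> complex \<Rightarrow> bilmap \<times> bilmap" where
  "nf_alt s c d = (table (s *s e1 + c *s e2) (s *s e2) (s *s e2) 0, table 0 (d *s e2) (- d *s e2) 0)"

lemma nf_idem_in_orbit_T3:
  assumes "t \<noteq> 0" shows "nf_idem t \<in> orbit T3"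
proof -
  \<comment> \<open>Since \<open>e2\<close> squares to \<open>t\<close> times itself, this multiple
    is the second idempotent.\<close>
  define w where "w = (1 / t) *s e2"
  have D: "vdet e1 w \<noteq> 0" using assms by (simp add: vdet_def w_def)
  have "nf_idem t = act (frame e1 w) T3"
    unfolding nf_idem_def T3_def
    by (rule act_frame_eq[symmetric])
      (use assms D in \<open>simp_all add: V_eq_iff w_def\<close>)
  then show ?thesis using D GL_iff unfolding orbit_def by blast
qed

lemma nf_sym_in_orbit_T4:
  assumes "s \<noteq> 0" "d \<noteq> 0" shows "nf_sym s c d \<in> orbit T4"
proof -
  \<comment> \<open>\<open>u\<close> is the unit of the commutative product, and \<open>w\<close>
    below is its bracket square \<open>[u,u]\<close>.\<close>
  define u where "u = (1 / s) *s e1 - (c / s\<^sup>2) *s e2"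
  define w where "w = (d / s\<^sup>2) *s e2"
  have D: "vdet u w \<noteq> 0" using assms by (simp add: vdet_def u_def w_def)
  have "nf_sym s c d = act (frame u w) T4"
    unfolding nf_sym_def T4_def
    by (rule act_frame_eq[symmetric])
      (use assms D in \<open>simp_all add: V_eq_iff u_def w_def field_simps power2_eq_square\<close>)
  then show ?thesis using D GL_iff unfolding orbit_def by blast
qed

lemma nf_alt_in_orbit_T5:
  assumes "s \<noteq> 0" shows "nf_alt s c d \<in> orbit (T5 (d / s))"
proof -
  \<comment> \<open>Again the unit of the product; its bracket with \<open>e2\<close> is
    \<open>d / s\<close> times \<open>e2\<close>, which is the value of \<alpha>.\<close>
  define u where "u = (1 / s) *s e1 - (c / s\<^sup>2) *s e2"
  have D: "vdet u e2 \<noteq> 0" using assms by (simp add: vdet_def u_def)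
  have "nf_alt s c d = act (frame u e2) (T5 (d / s))"
    unfolding nf_alt_def T5_def
    by (rule act_frame_eq[symmetric])
      (use assms D in \<open>simp_all add: V_eq_iff u_def field_simps power2_eq_square\<close>)
  then show ?thesis using D GL_iff unfolding orbit_def by blast
qed

text \<open>For fixed \<open>g\<close> the determinant is a constant, so moving the curve by
  \<open>g\<close> keeps it polynomial. Normal forms thus need to be deformed only in one
  basis.\<close>

lemma act_curve_in_closure:
  assumes "g \<in> GL" "curve F" "univ_poly D" "D a \<noteq> 0" "S \<subseteq> TLP"
    and "\<And>h t. h \<in> GL \<Longrightarrow> D t \<noteq> 0 \<Longrightarrow> act h (F t) \<in> S"
  shows "act g (F t) \<in> zariski_Bil2 closure_of S"
proof -
  obtain u w where g: "vdet u w \<noteq> 0" "g = frame u w"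
    using assms(1) GL_iff by blast
  have "F t \<in> Bil \<times> Bil" for t using assms(2) by (simp add: curve_def)
  then have "act g (F t) = scaled_act (1 / (vdet u w)\<^sup>2) u w (F t)" for t
    using act_frame g by simp
  moreover have "curve (\<lambda>t. scaled_act (1 / (vdet u w)\<^sup>2) u w (F t))"
    by (intro curve_scaled_act assms(2)) simp_all
  ultimately have "curve (\<lambda>t. act g (F t))" by simp
  then show ?thesis
    by (rule curve_in_closure[where D = D and a = a]) (use assms TLP_subset_Bil in auto)
qed

lemma nf_idem_in_closure:
  assumes "g \<in> GL" shows "act g (nf_idem t) \<in> zariski_Bil2 closure_of orbit T3"
  by (rule act_curve_in_closure[where D = "\<lambda>t. t" and a = 1])
    (auto simp: assms orbit_subset_TLP T3_in_TLP nf_idem_def intro!: curve_table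
      intro: orbit_act[OF nf_idem_in_orbit_T3, unfolded nf_idem_def])

lemma nf_sym_in_closure:
  assumes "g \<in> GL" shows "act g (nf_sym s c d) \<in> zariski_Bil2 closure_of orbit T4"
proof -
  \<comment> \<open>Shifting \<open>s\<close> and \<open>d\<close> together makes both nonzero for
    all but at most two values of \<open>t\<close>; \<open>t = 0\<close> is the given
    structure.\<close>
  define F where "F = (\<lambda>t. nf_sym (s + t) c (d + t))"
  define D where "D = (\<lambda>t. (s + t) * (d + t))"
  have "univ_poly D" by (simp add: D_def)
  moreover have "\<exists>a. D a \<noteq> 0"
    using univ_poly_common_nonzero[of "\<lambda>t. s + t" "\<lambda>t. d + t" "1 - s" "1 - d"] by (simp add: D_def)
  moreover have "curve F"
    unfolding F_def nf_sym_def by (intro curve_table) simp_all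
  moreover have "act h (F t) \<in> orbit T4" if "h \<in> GL" "D t \<noteq> 0" for h t
    using that by (auto simp: F_def D_def intro: orbit_act nf_sym_in_orbit_T4)
  ultimately have "act g (F 0) \<in> zariski_Bil2 closure_of orbit T4"
    using act_curve_in_closure[OF assms] orbit_subset_TLP[OF T4_in_TLP] by blast
  then show ?thesis by (simp add: F_def)
qed

lemma nf_alt_in_closure:
  assumes "g \<in> GL" shows "act g (nf_alt s c d) \<in> zariski_Bil2 closure_of (\<Union>\<alpha>. orbit (T5 \<alpha>))"
proof -
  \<comment> \<open>Only \<open>s\<close> has to become nonzero. The parameter
    \<open>d / (s + t)\<close> may vary along the curve, which therefore runs in the union of the
    orbits.\<close>
  define F where "F = (\<lambda>t. nf_alt (s + t) c d)"
  have "univ_poly (\<lambda>t. s + t)" by simp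
  moreover have "s + (1 - s) \<noteq> 0" by simp
  moreover have "curve F"
    unfolding F_def nf_alt_def by (intro curve_table) simp_all
  moreover have "act h (F t) \<in> (\<Union>\<alpha>. orbit (T5 \<alpha>))" if "h \<in> GL" "s + t \<noteq> 0" for h t
    unfolding F_def using orbit_act[OF nf_alt_in_orbit_T5[OF that(2)] that(1)] by blast
  moreover have "(\<Union>\<alpha>. orbit (T5 \<alpha>)) \<subseteq> TLP"
    using orbit_subset_TLP[OF T5_in_TLP] by blast
  ultimately have "act g (F 0) \<in> zariski_Bil2 closure_of (\<Union>\<alpha>. orbit (T5 \<alpha>))"
    by (intro act_curve_in_closure[OF assms, where D = "\<lambda>t. s + t" and a = "1 - s"])
  then show ?thesis by (simp add: F_def)
qed

subsection \<open>Classification\<close>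

lemma basis_coords:
  assumes "vdet u w \<noteq> 0"
  obtains a b where "x = a *s u + b *s w"
proof
  define y where "y = (1 / vdet u w) *s adj_frame u w x"
  have "x = frame u w y"
    using assms by (simp add: y_def frame_scale frame_adj)
  then show "x = y$1 *s u + y$2 *s w" by (simp add: frame_def)
qed

lemma basis_unique:
  assumes "vdet u w \<noteq> 0" "a *s u + b *s w = c *s u + d *s w"
  shows "a = c" "b = d"
proof -
  have "frame u w (a *s e1 + b *s e2) = frame u w (c *s e1 + d *s e2)"
    using assms(2) by (simp add: frame_def)
  then have "a *s e1 + b *s e2 = c *s e1 + d *s e2"
    using bij_frame[OF assms(1)] by (simp add: bij_def inj_eq)
  then show "a = c" "b = d" by (simp_all add: V_eq_iff)
qed

lemma basis_zero:
  assumes "vdet u w \<noteq> 0" "a *s u + b *s w = 0"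
  shows "a = 0" "b = 0"
  using basis_unique[OF assms(1), of a b 0 0] assms(2) by (simp_all add: vector_smult_lzero)

lemma vdet_zero_multiple:
  assumes "vdet u w = 0" "u \<noteq> 0"
  obtains k where "w = k *s u"
proof (cases "u$1 = 0")
  case True
  then have "w = (w$2 / u$2) *s u" using assms by (simp add: V_eq_iff vdet_def)
  then show ?thesis by (rule that)
next
  case False
  then have "w = (w$1 / u$1) *s u" using assms by (simp add: V_eq_iff vdet_def field_simps)
  then show ?thesis by (rule that)
qed

lemma basis_extend:
  assumes "w \<noteq> 0"
  obtains u where "vdet u w \<noteq> 0"
proof (cases "w$1 = 0")
  case True
  then have "vdet e1 w \<noteq> 0" using assms by (simp add: V_eq_iff vdet_def)
  then show ?thesis by (rule that)
next
  case False
  then have "vdet e2 w \<noteq> 0" by (simp add: vdet_def)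
  then show ?thesis by (rule that)
qed

lemma clinear_eigenvector:
  assumes "clinear f"
  obtains v \<mu> where "v \<noteq> 0" "f v = \<mu> *s v"
proof -
  define a b c d where abcd: "a = f e1 $ 1" "b = f e2 $ 1" "c = f e1 $ 2" "d = f e2 $ 2"
  have f: "f v $ 1 = a * v$1 + b * v$2" "f v $ 2 = c * v$1 + d * v$2" for v
  proof -
    have "v = v$1 *s e1 + v$2 *s e2" by (simp add: V_eq_iff)
    then have "f v = v$1 *s f e1 + v$2 *s f e2"
      using assms unfolding clinear_iff by metis
    then show "f v $ 1 = a * v$1 + b * v$2" "f v $ 2 = c * v$1 + d * v$2"
      by (simp_all add: abcd)
  qed
  define r where "r = csqrt ((a - d)\<^sup>2 + 4 * b * c)"
  define \<mu> where "\<mu> = (a + d + r) / 2"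
  have "r\<^sup>2 = (a - d)\<^sup>2 + 4 * b * c" by (simp add: r_def)
  moreover have "r = 2 * \<mu> - a - d" by (simp add: \<mu>_def field_simps)
  ultimately have "(2 * \<mu> - a - d)\<^sup>2 = (a - d)\<^sup>2 + 4 * b * c" by simp
  then have "4 * ((a - \<mu>) * (d - \<mu>)) = 4 * (b * c)"
    by algebra
  then have \<mu>: "(a - \<mu>) * (d - \<mu>) = b * c" by simp
  \<comment> \<open>The first two cases provide the kernel vectors \<open>(b, \<mu> - a)\<close> and
    \<open>(\<mu> - d, c)\<close> of \<open>f - \<mu>\<close>; if both are zero, \<open>f\<close> is
    scalar.\<close>
  consider "b \<noteq> 0 \<or> a \<noteq> \<mu>" | "c \<noteq> 0 \<or> d \<noteq> \<mu>" | "b = 0" "c = 0" "a = \<mu>" "d = \<mu>"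
    by blast
  then show ?thesis
  proof cases
    case 1
    show ?thesis
      by (rule that[of "b *s e1 + (\<mu> - a) *s e2" \<mu>])
        (use 1 \<mu> in \<open>auto simp: V_eq_iff f algebra_simps\<close>)
  next
    case 2
    show ?thesis
      by (rule that[of "(\<mu> - d) *s e1 + c *s e2" \<mu>])
        (use 2 \<mu> in \<open>auto simp: V_eq_iff f algebra_simps\<close>)
  next
    case 3
    show ?thesis
      by (rule that[of e1 \<mu>]) (use 3 in \<open>auto simp: V_eq_iff f\<close>)
  qed
qed

text \<open>The multiplications commute, so each preserves an eigenspace of a non-scalar one, and in
  the plane that eigenspace is a line. If all are scalar, any nonzero vector serves.\<close>

lemma common_eigenvector:
  assumes m: "m \<in> Bil" and comm: "\<And>x y. m x y = m y x"
    and assoc: "\<And>x y z. m (m x y) z = m x (m y z)"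
  shows "\<exists>w ev. w \<noteq> 0 \<and> (\<forall>x. m x w = ev x *s w)"
proof (cases "\<forall>z. \<exists>k. \<forall>x. m z x = k *s x")
  case True
  then obtain ev where "\<And>z x. m z x = ev z *s x" by metis
  then show ?thesis by (intro exI[of _ e1] exI[of _ ev]) (auto simp: V_eq_iff)
next
  case False
  then obtain z where z: "\<nexists>k. \<forall>x. m z x = k *s x" by blast
  have "clinear (m z)" using m by (simp add: Bil_def)
  then obtain v \<mu> where v: "v \<noteq> 0" "m z v = \<mu> *s v" by (rule clinear_eigenvector)
  have "\<exists>k. m x v = k *s v" for x
  proof -
    have *: "m z (m x v) = \<mu> *s m x v"
    proof -
      have "m z (m x v) = m x (m z v)" using assoc comm by metis
      then show ?thesis by (simp add: v BilD[OF m])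
    qed
    have "vdet v (m x v) = 0"
    proof (rule ccontr)
      assume D: "vdet v (m x v) \<noteq> 0"
      \<comment> \<open>Both \<open>v\<close> and \<open>m x v\<close> are eigenvectors for \<mu>;
        if they formed a basis, \<open>m z\<close> would be scalar.\<close>
      have "m z y = \<mu> *s y" for y
      proof -
        obtain a b where y: "y = a *s v + b *s m x v" using basis_coords[OF D] .
        show ?thesis unfolding y BilD[OF m] v(2) * by (simp add: V_eq_iff algebra_simps)
      qed
      with z show False by blast
    qed
    then show ?thesis using vdet_zero_multiple v(1) by metis
  qed
  then obtain ev where "\<And>x. m x v = ev x *s v" by metis
  with v(1) show ?thesis by blast
qed

lemma zero_Bil: "(\<lambda>x y. 0) \<in> Bil"
  by (simp add: Bil_iff)

text \<open>A common eigenvector \<open>w\<close> is either proportional to an idempotent or of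
  square zero. In the second case associativity leaves the shape of \<open>nf_sym\<close> or yields
  an idempotent that kills \<open>w\<close>.\<close>

lemma associative_normal_form:
  assumes m: "m \<in> Bil" and comm: "\<And>x y. m x y = m y x"
    and assoc: "\<And>x y z. m (m x y) z = m x (m y z)"
  shows "\<exists>g\<in>GL. (\<exists>t. (m, \<lambda>x y. 0) = act g (nf_idem t)) \<or>
    (\<exists>s c d. (m, \<lambda>x y. 0) = act g (nf_sym s c d))"
proof -
  note lin = BilD[OF m]
  have idem: ?thesis
    if D: "vdet e n \<noteq> 0" and ee: "m e e = e" and en: "m e n = 0" for e n
  proof -
    obtain a t where nn: "m n n = a *s e + t *s n" using basis_coords[OF D] .
    \<comment> \<open>As \<open>e(nn) = (en)n = 0\<close>, the square of \<open>n\<close> has no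
      component along \<open>e\<close>.\<close>
    have "m e (m n n) = 0" using assoc[of e n n] en by (simp add: lin)
    then have "a *s e + 0 *s n = 0" by (simp add: nn lin ee en)
    then have "a = 0" by (rule basis_zero[OF D])
    then have "(m, \<lambda>x y. 0) = act (frame e n) (nf_idem t)"
      unfolding nf_idem_def
      by (intro act_frame_eq[symmetric] m zero_Bil D)
        (use ee en nn comm[of n e] in \<open>simp_all add: V_eq_iff\<close>)
    with frame_in_GL[OF D] show ?thesis by blast
  qed
  obtain w ev where w: "w \<noteq> 0" "\<And>x. m x w = ev x *s w"
    using common_eigenvector[OF m comm assoc] by blast
  obtain u where D: "vdet u w \<noteq> 0" using basis_extend[OF w(1)] .
  show ?thesis
  proof (cases "ev w = 0")
    case False
    define e where "e = (1 / ev w) *s w"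
    \<comment> \<open>Because \<open>e u = ev u *s e\<close>, subtracting this multiple of
      \<open>e\<close> gives a vector killed by \<open>e\<close>.\<close>
    define n where "n = u + (- ev u) *s e"
    show ?thesis
    proof (rule idem)
      show "vdet e n \<noteq> 0"
        using D False by (simp add: e_def n_def vdet_def field_simps)
      show ee: "m e e = e"
        unfolding e_def lin w(2)[of w] using False by (simp add: V_eq_iff)
      have eu: "m e u = ev u *s e"
        by (subst comm) (simp add: e_def lin w(2)[of u] V_eq_iff)
      show "m e n = 0"
        unfolding n_def lin eu ee by (simp add: V_eq_iff)
    qed
  next
    case True
    obtain a c where uu: "m u u = a *s u + c *s w" using basis_coords[OF D] .
    define s where "s = ev u"
    have prods: "m u w = s *s w" "m w u = s *s w" "m w w = 0"
      using w(2) True comm[of w u] by (simp_all add: s_def)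
    have "m (m u u) w = m u (m u w)" by (rule assoc)
    then have "0 *s u + (a * s) *s w = 0 *s u + (s * s) *s w"
      by (simp add: uu prods lin)
    then have "a * s = s * s" by (rule basis_unique[OF D])
    then consider "a = s" | "s = 0" "a \<noteq> 0" by auto
    then show ?thesis
    proof cases
      case 1
      have "(m, \<lambda>x y. 0) = act (frame u w) (nf_sym s c 0)"
        unfolding nf_sym_def
        by (intro act_frame_eq[symmetric] m zero_Bil D)
          (simp_all add: V_eq_iff uu prods 1)
      with frame_in_GL[OF D] show ?thesis by blast
    next
      case 2
      \<comment> \<open>This is \<open>m u u\<close> divided by \<open>a^2\<close>: as
        \<open>w\<close> is now annihilated by everything, only the square of \<open>u\<close>
        contributes to \<open>m e e\<close>.\<close>
      define e where "e = (1 / a) *s u + (c / a\<^sup>2) *s w"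
      show ?thesis
      proof (rule idem)
        show "vdet e w \<noteq> 0" using D 2 by (simp add: e_def vdet_def field_simps)
        show "m e e = e" "m e w = 0"
          using 2 by (simp_all add: e_def lin uu prods V_eq_iff field_simps power2_eq_square)
      qed
    qed
  qed
qed

lemma square_normal_form:
  assumes m: "m \<in> Bil" and b: "b \<in> Bil" and leib: "symmetric_leibniz b"
    and comm: "\<And>x y. m x y = m y x"
    and compat: "\<And>x y z. 2 *s m (b x y) z = b (m x z) y + b x (m y z)"
    and u: "b u u \<noteq> 0"
  shows "\<exists>g\<in>GL. \<exists>s c d. (m, b) = act g (nf_sym s c d)"
proof -
  define w where "w = b u u"
  \<comment> \<open>In one law the two outer arguments are \<open>u\<close>, in the other the last
    two; the equal terms cancel, leaving \<open>b w z = 0\<close> and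
    \<open>b x w = 0\<close>.\<close>
  have "b x (b u z) = b (b x u) z + b u (b x z)" "b (b x u) z = b (b x z) u + b x (b u z)" for x z
    using leib unfolding symmetric_leibniz_def by blast+
  then have "b u (b u z) = b w z + b u (b u z)" "b (b x u) u = b (b x u) u + b x w" for x z
    unfolding w_def by blast+
  then have ann: "b w z = 0" "b x w = 0" for x z
    by simp_all
  have D: "vdet u w \<noteq> 0"
  proof
    assume "vdet u w = 0"
    moreover have "u \<noteq> 0" using u BilD[OF b] by auto
    ultimately obtain k where k: "w = k *s u" by (rule vdet_zero_multiple)
    then have "k *s b u u = 0" using ann(2)[of u] by (simp add: BilD[OF b])
    then show False using u k w_def by (auto simp: V_eq_iff)
  qed
  obtain s c where uu: "m u u = s *s u + c *s w" using basis_coords[OF D] .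
  \<comment> \<open>Both bracket terms of the compatibility law give \<open>s w\<close>, since the
    \<open>w\<close>-part of \<open>u\<close> squared is annihilated.\<close>
  have "2 *s m w u = 2 *s (s *s w)"
    using compat[of u u u] by (simp add: uu BilD[OF b] ann flip: w_def) (simp add: V_eq_iff)
  then have wu: "m w u = s *s w" by (simp add: V_eq_iff)
  then have uw: "m u w = s *s w" using comm by simp
  have "2 *s m w w = 0"
    using compat[of u u w] by (simp add: uw BilD[OF b] ann flip: w_def)
  then have ww: "m w w = 0" by (simp add: V_eq_iff)
  \<comment> \<open>The last parameter is 1 because the second basis vector is \<open>[u,u]\<close>
    itself.\<close>
  have "(m, b) = act (frame u w) (nf_sym s c 1)"
    unfolding nf_sym_def
    by (intro act_frame_eq[symmetric] m b D) (simp_all add: V_eq_iff uu wu uw ww ann flip: w_def)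
  with frame_in_GL[OF D] show ?thesis by blast
qed

text \<open>An alternating bracket on the plane is the determinant times the fixed vector
  \<open>n = [e1,e2]\<close>. Compatibility on a basis containing \<open>n\<close> then determines
  the products with \<open>n\<close>.\<close>

lemma alternating_normal_form:
  assumes m: "m \<in> Bil" and b: "b \<in> Bil" and alt: "\<And>x. b x x = 0"
    and comm: "\<And>x y. m x y = m y x"
    and compat: "\<And>x y z. 2 *s m (b x y) z = b (m x z) y + b x (m y z)"
    and nz: "b e1 e2 \<noteq> 0"
  shows "\<exists>g\<in>GL. \<exists>s c d. (m, b) = act g (nf_alt s c d)"
proof -
  define n where "n = b e1 e2"
  have anti: "b y x = - b x y" for x y
    using alt[of "x + y"] unfolding BilD[OF b] by (simp add: alt eq_neg_iff_add_eq_0 add.commute)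
  have b_eq: "b x y = vdet x y *s n" for x y
    by (subst Bil_table[OF b])
      (simp add: V_eq_iff alt vdet_def n_def anti[of e1 e2] algebra_simps)
  obtain u where D: "vdet u n \<noteq> 0" using basis_extend nz n_def by metis
  define d where "d = vdet u n"
  have bu: "b u u = 0" "b n n = 0" "b u n = d *s n" "b n u = (- d) *s n"
    by (simp_all add: b_eq vdet_def d_def algebra_simps)
  have d0: "d \<noteq> 0" and n0: "n \<noteq> 0" using D nz by (simp_all add: d_def n_def)
  obtain s c where uu: "m u u = s *s u + c *s n" using basis_coords[OF D] .
  obtain p q where nu: "m n u = p *s u + q *s n" using basis_coords[OF D] .
  obtain p' q' where nn: "m n n = p' *s u + q' *s n" using basis_coords[OF D] .
  have un: "m u n = p *s u + q *s n" using nu comm by simp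
  \<comment> \<open>The right-hand side of compatibility is a multiple of \<open>n\<close>, so
    \<open>p = 0\<close>, while \<open>2 q = s + q\<close> gives \<open>q = s\<close>. The same
    comparison for \<open>n\<close> squared reads \<open>2 q' = q'\<close>.\<close>
  have "(2 * d * p) *s u + (2 * d * q) *s n = 0 *s u + (d * (s + q)) *s n"
    using compat[of u n u] by (simp add: uu nu bu BilD[OF b] BilD[OF m] V_eq_iff algebra_simps)
  from basis_unique[OF D this] d0 have pq: "p = 0" "q = s" by (auto simp: algebra_simps)
  have "(2 * d * p') *s u + (2 * d * q') *s n = 0 *s u + (d * q') *s n"
    using compat[of u n n] by (simp add: un nn pq bu BilD[OF b] BilD[OF m] V_eq_iff algebra_simps)
  from basis_unique[OF D this] d0 have pq': "p' = 0" "q' = 0" by auto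
  have "(m, b) = act (frame u n) (nf_alt s c d)"
    unfolding nf_alt_def
    by (intro act_frame_eq[symmetric] m b D) (simp_all add: V_eq_iff uu nu un nn bu pq pq')
  with frame_in_GL[OF D] show ?thesis by blast
qed

lemma TLP_normal_form:
  assumes "p \<in> TLP"
  shows "\<exists>g\<in>GL. (\<exists>t. p = act g (nf_idem t)) \<or> (\<exists>s c d. p = act g (nf_sym s c d)) \<or>
    (\<exists>s c d. p = act g (nf_alt s c d))"
proof -
  obtain m b where p: "p = (m, b)" by fastforce
  have tlp: "transposed_leibniz_poisson m b" using assms p by (simp add: TLP_def)
  then have m: "m \<in> Bil" and b: "b \<in> Bil" and leib: "symmetric_leibniz b"
    unfolding transposed_leibniz_poisson_def by blast+
  have comm: "m x y = m y x" and assoc: "m (m x y) z = m x (m y z)"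
    and compat: "2 *s m (b x y) z = b (m x z) y + b x (m y z)" for x y z
    using tlp unfolding transposed_leibniz_poisson_def by blast+
  consider u where "b u u \<noteq> 0" | "\<And>x. b x x = 0" "b e1 e2 \<noteq> 0" | "\<And>x. b x x = 0" "b e1 e2 = 0"
    by blast
  then show ?thesis
  proof cases
    case 1
    from square_normal_form[OF m b leib comm compat this] show ?thesis unfolding p by blast
  next
    case 2
    from alternating_normal_form[OF m b 2(1) comm compat 2(2)] show ?thesis unfolding p by blast
  next
    case 3
    have "b e2 e1 = 0"
      using 3(1)[of "e1 + e2"] unfolding BilD[OF b] by (simp add: 3)
    then have b0: "b = (\<lambda>x y. 0)"
      by (subst Bil_table[OF b]) (simp add: 3 fun_eq_iff V_eq_iff)
    from associative_normal_form[OF m comm assoc] show ?thesis unfolding p b0 by blast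
  qed
qed

subsection \<open>The components\<close>

text \<open>The discriminant of the characteristic polynomial of \<open>x \<mapsto> e1 \<cdot> x\<close>.\<close>

definition left_disc :: "bilmap \<times> bilmap \<Rightarrow> complex" where
  "left_disc p = (fst p e1 e1 $ 1 - fst p e1 e2 $ 2)\<^sup>2 + 4 * (fst p e1 e2 $ 1) * (fst p e1 e1 $ 2)"

lemma regular_left_disc: "regular left_disc"
proof -
  have "regular (\<lambda>p. (fst p e1 e1 $ 1 - fst p e1 e2 $ 2) * (fst p e1 e1 $ 1 - fst p e1 e2 $ 2) +
      4 * (fst p e1 e2 $ 1) * (fst p e1 e1 $ 2))"
    by simp
  then show ?thesis unfolding left_disc_def[abs_def] power2_eq_square .
qed

text \<open>The product is that of the dual numbers, where multiplication by any element has a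
  double eigenvalue. This is invariant under change of basis, and the bracket \<open>b\<close> does
  not enter.\<close>

lemma left_disc_orbit_dual_numbers:
  assumes "p \<in> orbit (table e1 e2 e2 0, b)" "b \<in> Bil"
  shows "left_disc p = 0"
proof -
  obtain u w where D: "vdet u w \<noteq> 0" and p: "p = act (frame u w) (table e1 e2 e2 0, b)"
    using assms(1) unfolding orbit_def GL_iff by blast
  have "p = scaled_act (1 / (vdet u w)\<^sup>2) u w (table e1 e2 e2 0, b)"
    unfolding p by (rule act_frame[OF D]) (simp add: assms(2))
  \<comment> \<open>The discriminant is homogeneous of degree two in the structure constants, so the
    scalar comes out squared and leaves a polynomial identity.\<close>
  then have "left_disc p = (1 / (vdet u w)\<^sup>2)\<^sup>2 * left_disc (scaled_act 1 u w (table e1 e2 e2 0, b))"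
    unfolding left_disc_def by (simp add: scaled_act_def power2_eq_square algebra_simps)
  also have "left_disc (scaled_act 1 u w (table e1 e2 e2 0, b)) = 0"
    by (simp add: scaled_act_def left_disc_def power2_eq_square algebra_simps)
  finally show ?thesis by simp
qed

theorem theorem29:
  "irreducible_components_of (subtopology zariski_Bil2 TLP) =
     {zariski_Bil2 closure_of orbit T3,
      zariski_Bil2 closure_of orbit T4,
      zariski_Bil2 closure_of (\<Union>\<alpha>. orbit (T5 \<alpha>))} \<and>
   card (irreducible_components_of (subtopology zariski_Bil2 TLP)) = 3"
proof -
  let ?S5 = "\<Union>\<alpha>. orbit (T5 \<alpha>)"
  let ?C3 = "zariski_Bil2 closure_of orbit T3"
  let ?C4 = "zariski_Bil2 closure_of orbit T4"
  let ?C5 = "zariski_Bil2 closure_of ?S5"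
  let ?\<C> = "{?C3, ?C4, ?C5}"
  have sub: "orbit T3 \<subseteq> TLP" "orbit T4 \<subseteq> TLP" "?S5 \<subseteq> TLP"
    using orbit_subset_TLP T3_in_TLP T4_in_TLP T5_in_TLP by blast+
  then have subB: "orbit T3 \<subseteq> Bil \<times> Bil" "orbit T4 \<subseteq> Bil \<times> Bil" "?S5 \<subseteq> Bil \<times> Bil"
    using TLP_subset_Bil by blast+
  have C3: "snd p x y $ k = 0" if "p \<in> ?C3" for p x y k
    by (rule regular_zero_closure[OF that _ _ subB(1)])
      (auto simp: orbit_def act_def T3_def table_def GL_0)
  have C4: "snd p x y $ k - snd p y x $ k = 0" if "p \<in> ?C4" for p x y k
    by (rule regular_zero_closure[OF that _ _ subB(2)])
      (auto simp: orbit_def act_def T4_def table_def mult.commute)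
  have T5_alt: "snd (T5 \<alpha>) x y = - snd (T5 \<alpha>) y x" for \<alpha> x y
    by (simp add: T5_def V_eq_iff)
  have C5: "snd p x y $ k + snd p y x $ k = 0" if "p \<in> ?C5" for p x y k
  proof (rule regular_zero_closure[OF that _ _ subB(3)])
    fix q assume "q \<in> ?S5"
    then obtain \<alpha> g where g: "g \<in> GL" "q = act g (T5 \<alpha>)" unfolding orbit_def by blast
    have "snd q x y = - snd q y x"
      unfolding g(2) act_def snd_conv
      by (subst T5_alt) (simp add: GL_uminus[OF g(1)])
    then show "snd q x y $ k + snd q y x $ k = 0" by simp
  qed auto
  have disc: "left_disc p = 0" if "p \<in> ?C4 \<or> p \<in> ?C5" for p
    using that
  proof
    assume "p \<in> ?C4"
    then show ?thesis
      by (rule regular_zero_closure[OF _ regular_left_disc _ subB(2)])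
        (simp add: T4_def left_disc_orbit_dual_numbers)
  next
    assume "p \<in> ?C5"
    then show ?thesis
      by (rule regular_zero_closure[OF _ regular_left_disc _ subB(3)])
        (auto simp: T5_def left_disc_orbit_dual_numbers)
  qed
  \<comment> \<open>The value \<alpha> = 1 gives a nonzero antisymmetric bracket, which separates
    \<open>T5 1\<close> from the closures for \<open>T3\<close> and \<open>T4\<close>.\<close>
  have mem: "T3 \<in> ?C3" "T4 \<in> ?C4" "T5 1 \<in> ?C5"
  proof -
    have "orbit T3 \<subseteq> ?C3" "orbit T4 \<subseteq> ?C4" "?S5 \<subseteq> ?C5"
      using subB by (simp_all add: closure_of_subset)
    then show "T3 \<in> ?C3" "T4 \<in> ?C4" "T5 1 \<in> ?C5"
      using self_in_orbit by blast+
  qed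
  \<comment> \<open>Multiplication by \<open>e1\<close> has the distinct eigenvalues 1 and 0 in
    \<open>T3\<close>.\<close>
  have "left_disc T3 \<noteq> 0" by (simp add: left_disc_def T3_def)
  then have "T3 \<notin> ?C4" "T3 \<notin> ?C5" using disc by blast+
  moreover have "T4 \<notin> ?C3" using C3[of T4 e1 e1 2] by (auto simp: T4_def)
  moreover have "T4 \<notin> ?C5" using C5[of T4 e1 e1 2] by (auto simp: T4_def)
  moreover have "T5 1 \<notin> ?C3" using C3[of "T5 1" e1 e2 2] by (auto simp: T5_def)
  moreover have "T5 1 \<notin> ?C4" using C4[of "T5 1" e1 e2 2] by (auto simp: T5_def)
  ultimately have incl: "\<not> ?C3 \<subseteq> ?C4" "\<not> ?C3 \<subseteq> ?C5" "\<not> ?C4 \<subseteq> ?C3" "\<not> ?C4 \<subseteq> ?C5"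
    "\<not> ?C5 \<subseteq> ?C3" "\<not> ?C5 \<subseteq> ?C4"
    using mem by blast+
  have const: "curve (\<lambda>_. p)" if "p \<in> TLP" for p
    using that TLP_subset_Bil by (auto simp: curve_def)
  have "curve T5"
    unfolding T5_def[abs_def] by (rule curve_table) simp_all
  then have irred: "irreducible_in (subtopology zariski_Bil2 TLP) C" if "C \<in> ?\<C>" for C
    using that irreducible_closure_orbits[of T5] irreducible_closure_orbits[OF const[OF T3_in_TLP]]
      irreducible_closure_orbits[OF const[OF T4_in_TLP]] T3_in_TLP T4_in_TLP T5_in_TLP
    by auto
  \<comment> \<open>Each closure is closed in the ambient space; that it lies in \<open>TLP\<close>
    is part of its irreducibility there.\<close>
  have closed: "closedin (subtopology zariski_Bil2 TLP) C" if "C \<in> ?\<C>" for C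
    using that irred[OF that]
    by (auto simp: closedin_closed_subtopology[OF closedin_TLP] irreducible_in_iff)
  have cover: "topspace (subtopology zariski_Bil2 TLP) \<subseteq> \<Union>?\<C>"
  proof
    fix p assume "p \<in> topspace (subtopology zariski_Bil2 TLP)"
    then have "p \<in> TLP" by simp
    from TLP_normal_form[OF this] show "p \<in> \<Union>?\<C>"
      by (elim bexE disjE exE)
        (simp_all add: nf_idem_in_closure nf_sym_in_closure nf_alt_in_closure)
  qed
  have "irreducible_components_of (subtopology zariski_Bil2 TLP) = ?\<C>"
    by (rule irreducible_components_of_eqI)
      (use irred closed cover incl in auto)
  moreover have "card ?\<C> = 3"
    using incl by (auto simp: card_insert_if)
  ultimately show ?thesis by simp
qed

end
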